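(* Let $X,X_1,X_2,\dots$ be i.i.d. positive random variables, let $p\ge 2$ be an integer, and set $$T_n=\frac{X_1^2+\dots+X_n^2}{X_1+\dots+X_n},\qquad M_n=\max_{1\le i\le n}X_i,\qquad R_n^{(p)}=\frac{T_n^pM_n^2}{X_1+\dots+X_n}.$$ If $\mathbb{P}(X\ge x)=O(x^{-p-7/2})$ as $x\to+\infty$, then $\mathbb{E}R_n^{(p)}=O(n^{-1/2})$. When $p>8$ and $\mathbb{E}X^{p+4}<\infty$, one has $\mathbb{E}R_n^{(p)}=O(n^{-(p-2)/(p+4)})$. Moreover, if $\mathbb{E}e^{\varepsilon X}<\infty$ for some $\varepsilon>0$, then $\mathbb{E}R_n^{(p)}=O\left(\frac{(\log n)^2}{n}\right)$. *)

theory Defs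
  imports "HOL-Probability.Probability" "HOL-Library.Landau_Symbols"
begin

definition Sn :: "(nat \<Rightarrow> 'a \<Rightarrow> real) \<Rightarrow> nat \<Rightarrow> 'a \<Rightarrow> real" where
  "Sn X n \<omega> = (\<Sum>i=1..n. X i \<omega>)"

definition Tn :: "(nat \<Rightarrow> 'a \<Rightarrow> real) \<Rightarrow> nat \<Rightarrow> 'a \<Rightarrow> real" where
  "Tn X n \<omega> = (\<Sum>i=1..n. (X i \<omega>)^2) / Sn X n \<omega>"

definition Mn :: "(nat \<Rightarrow> 'a \<Rightarrow> real) \<Rightarrow> nat \<Rightarrow> 'a \<Rightarrow> real" where
  "Mn X n \<omega> = Max ((\<lambda>i. X i \<omega>) ` {1..n})"

definition Rn :: "nat \<Rightarrow> (nat \<Rightarrow> 'a \<Rightarrow> real) \<Rightarrow> nat \<Rightarrow> 'a \<Rightarrow> real" where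
  "Rn p X n \<omega> = (Tn X n \<omega>)^p * (Mn X n \<omega>)^2 / Sn X n \<omega>"

end

(*
  Put S = S_n, V = X_1^2 + ... + X_n^2, mu = E X^2 and E exp (-X) = exp (-2c), so c > 0. Always
  R_n <= M_n^(p+1), and P(S < cn) is exponentially small. If S >= cn, then R_n <= T_n^p M_n^2 / (cn).
  For T_n bounded by K = (mu+2)/c this is a constant times M_n^2 / n, which is the main term.
  If T_n > K, then V > (mu+2) n. Singling out the index i with X_i = M_n, either X_i^2 > n or
  the centred sum W_i of the X_j^2 - mu over j <> i exceeds n; so M_n^(p+2) is at most
  X_i^(p+2+k) / n^(k/2) in the first case and X_i^(p+2) W_i^2 / n^2 in the second, where X_i and W_i
  are independent and E W_i^2 = O(n). Summing over i gives
    E R_n = O(E M_n^2 / n + n^(-k/2) + 1/n)   whenever E X^(p+2+k) is finite.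
  The three claims use k = 1, 2, 2 and truncation bounds for E M_n^2.
*)
theory Submission
  imports Defs
begin

section \<open>Elementary inequalities for powers\<close>

text \<open>A single term of the exponential series is at most the whole sum, since all terms are
  nonnegative.\<close>

lemma power_le_fact_exp:
  fixes x :: real
  assumes "x \<ge> 0"
  shows "x ^ m \<le> fact m * exp x"
proof -
  have "(\<Sum>n\<in>{m}. x ^ n /\<^sub>R fact n) \<le> (\<Sum>n. x ^ n /\<^sub>R fact n)"
    using assms exp_converges[of x] by (intro sum_le_suminf) (auto simp: sums_iff)
  also have "\<dots> = exp x"
    using exp_converges[of x] by (simp add: sums_iff)
  finally show ?thesis
    by (simp add: field_simps)
qed

text \<open>The factor \<open>(x / a) ^ l\<close> is at least 1. Above a threshold \<open>a\<close>,
  extra moments are thus traded for decay in \<open>a\<close>, as in Markov's inequality.\<close>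

lemma power_le_power_divide:
  fixes x a :: real
  assumes "0 < a" "a \<le> x"
  shows "x ^ m \<le> x ^ (m + l) / a ^ l"
proof -
  have "x ^ m * a ^ l \<le> x ^ m * x ^ l"
    using assms by (intro mult_left_mono power_mono) auto
  then show ?thesis
    using assms by (simp add: field_simps power_add)
qed

section \<open>Pathwise bounds at a fixed sample point with positive coordinates\<close>

lemma Mn_ge: "i \<in> {1..n} \<Longrightarrow> X i \<omega> \<le> Mn X n \<omega>"
  unfolding Mn_def by (intro Max_ge) auto

lemma Mn_attained:
  assumes "n \<ge> 1"
  obtains i where "i \<in> {1..n}" "Mn X n \<omega> = X i \<omega>"
proof -
  have "Mn X n \<omega> \<in> (\<lambda>i. X i \<omega>) ` {1..n}"
    unfolding Mn_def using assms by (intro Max_in) auto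
  then show ?thesis using that by blast
qed

context
  fixes X :: "nat \<Rightarrow> 'a \<Rightarrow> real" and n :: nat and \<omega> :: 'a
  assumes n: "n \<ge> 1" and X_pos: "\<And>i. X i \<omega> > 0"
begin

lemma Sn_pos: "Sn X n \<omega> > 0"
  unfolding Sn_def using n X_pos by (intro sum_pos) auto

lemma Mn_pos: "Mn X n \<omega> > 0"
  using Mn_attained[OF n] X_pos by metis

lemma Tn_nonneg: "Tn X n \<omega> \<ge> 0"
  unfolding Tn_def using Sn_pos by (intro divide_nonneg_pos sum_nonneg) auto

lemma Rn_nonneg: "Rn p X n \<omega> \<ge> 0"
  unfolding Rn_def using Tn_nonneg Sn_pos by simp

lemma Mn_le_Sn: "Mn X n \<omega> \<le> Sn X n \<omega>"
proof -
  obtain i where i: "i \<in> {1..n}" "Mn X n \<omega> = X i \<omega>"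
    using Mn_attained[OF n] .
  have "X i \<omega> \<le> Sn X n \<omega>"
    unfolding Sn_def using i X_pos by (intro member_le_sum) (auto intro: less_imp_le)
  with i show ?thesis by simp
qed

text \<open>T_n is a weighted mean of the X_i, with weights X_i / S_n, so it cannot exceed their
  maximum.\<close>

lemma Tn_le_Mn: "Tn X n \<omega> \<le> Mn X n \<omega>"
proof -
  have "(\<Sum>i=1..n. (X i \<omega>)\<^sup>2) \<le> (\<Sum>i=1..n. Mn X n \<omega> * X i \<omega>)"
    unfolding power2_eq_square
    by (intro sum_mono mult_right_mono Mn_ge less_imp_le[OF X_pos])
  then show ?thesis
    unfolding Tn_def using Sn_pos
    by (simp add: divide_le_eq sum_distrib_left Sn_def)
qed

text \<open>The index attaining the maximum depends on the sample point. Summing \<open>f\<close>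
  over all indices removes this dependence, so that expectations can later be taken term by
  term.\<close>

lemma Mn_power_le:
  assumes "\<And>i. 0 \<le> f i" "\<And>i. i \<in> {1..n} \<Longrightarrow> Mn X n \<omega> = X i \<omega> \<Longrightarrow> Mn X n \<omega> ^ m \<le> a + f i"
  shows "Mn X n \<omega> ^ m \<le> a + (\<Sum>i=1..n. f i)"
proof -
  obtain i where i: "i \<in> {1..n}" "Mn X n \<omega> = X i \<omega>"
    using Mn_attained[OF n] .
  have "f i \<le> (\<Sum>i=1..n. f i)"
    using i assms by (intro member_le_sum) auto
  with assms(2)[OF i] show ?thesis by simp
qed

text \<open>Uses T_n <= M_n and M_n / S_n <= 1. This crude bound serves where S_n has no useful
  lower bound.\<close>

lemma Rn_le_Mn_power: "Rn p X n \<omega> \<le> Mn X n \<omega> ^ (p + 1)"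
proof -
  have "Rn p X n \<omega> = Tn X n \<omega> ^ p * (Mn X n \<omega> * (Mn X n \<omega> / Sn X n \<omega>))"
    by (simp add: Rn_def power2_eq_square)
  also have "\<dots> \<le> Mn X n \<omega> ^ p * (Mn X n \<omega> * 1)"
    using Tn_nonneg Tn_le_Mn Mn_pos Mn_le_Sn Sn_pos
    by (intro mult_mono power_mono) auto
  finally show ?thesis by (simp add: mult.commute)
qed

text \<open>Every case distinction is absorbed into nonnegative terms whose expectations can be
  computed: exceptional events appear as extra powers, squares or an exponential that is at least 1
  on them. The inner sum omits \<open>i\<close> so that it will be independent of
  \<open>X i\<close>.\<close>

lemma Rn_le_regimes:
  fixes c \<mu> :: real and p k :: nat
  assumes c: "c > 0" and \<mu>: "\<mu> \<ge> 0"
  shows "Rn p X n \<omega> \<le>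
      (((\<mu> + 2) / c) ^ p * (Mn X n \<omega>)\<^sup>2
       + (\<Sum>i=1..n. X i \<omega> ^ (p + 2 + k) / sqrt n ^ k
            + X i \<omega> ^ (p + 2) * (\<Sum>j\<in>{1..n} - {i}. (X j \<omega>)\<^sup>2 - \<mu>)\<^sup>2 / (real n)\<^sup>2)) / (c * n)
      + (real n ^ (p + 1) * exp (c * n - Sn X n \<omega>) + (\<Sum>i=1..n. X i \<omega> ^ (p + 3) / (real n)\<^sup>2))"
    (is "_ \<le> (?A + (\<Sum>i=1..n. ?B i)) / _ + (?C + (\<Sum>i=1..n. ?D i))")
proof -
  note [simp] = less_imp_le[OF X_pos] less_imp_le[OF Mn_pos] less_imp_le[OF Sn_pos] Tn_nonneg
  have B: "?B i \<ge> 0" for i by simp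
  have D: "?D i \<ge> 0" for i by simp
  have A: "?A \<ge> 0" using c \<mu> by simp
  have C: "?C \<ge> 0" by simp
  show ?thesis
  proof (cases "Sn X n \<omega> < c * n")
    case True
    \<comment> \<open>Either the maximum is at most \<open>n\<close>, or two extra powers buy the
      factor \<open>1 / n ^ 2\<close>, which after summation over \<open>n\<close> indices leaves
      order \<open>1 / n\<close>.\<close>
    have "Mn X n \<omega> ^ (p + 1) \<le> real n ^ (p + 1) * 1 + (\<Sum>i=1..n. ?D i)"
    proof (rule Mn_power_le[OF D])
      fix i assume i: "i \<in> {1..n}" "Mn X n \<omega> = X i \<omega>"
      show "Mn X n \<omega> ^ (p + 1) \<le> real n ^ (p + 1) * 1 + ?D i"
      proof (cases "X i \<omega> \<le> n")
        case True
        then have "Mn X n \<omega> ^ (p + 1) \<le> real n ^ (p + 1)"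
          unfolding i(2) by (intro power_mono) auto
        then show ?thesis using D[of i] by linarith
      next
        case False
        then have "X i \<omega> ^ (p + 1) \<le> X i \<omega> ^ (p + 1 + 2) / real n ^ 2"
          using n by (intro power_le_power_divide) auto
        then show ?thesis using i(2) by (simp add: numeral_3_eq_3 add_increasing)
      qed
    qed
    \<comment> \<open>In this regime \<open>c * n - Sn X n \<omega>\<close> is positive, so its
      exponential is at least the factor 1 kept above.\<close>
    also have "\<dots> \<le> ?C + (\<Sum>i=1..n. ?D i)"
      using True by (intro add_right_mono mult_left_mono) auto
    also have "\<dots> \<le> (?A + (\<Sum>i=1..n. ?B i)) / (c * n) + \<dots>"
      using A c sum_nonneg[of "{1..n}" ?B, OF B] by simp
    finally show ?thesis using Rn_le_Mn_power[of p] by linarith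
  next
    case S: False
    have "Tn X n \<omega> ^ p * (Mn X n \<omega>)\<^sup>2 \<le> ?A + (\<Sum>i=1..n. ?B i)"
    proof (cases "Tn X n \<omega> \<le> (\<mu> + 2) / c")
      case True
      then have "Tn X n \<omega> ^ p * (Mn X n \<omega>)\<^sup>2 \<le> ?A"
        by (intro mult_right_mono power_mono) auto
      then show ?thesis using sum_nonneg[of "{1..n}" ?B, OF B] by linarith
    next
      case False
      \<comment> \<open>The division by \<open>c\<close> in the threshold for T_n compensates the
        lower bound \<open>c * n\<close> for S_n, leaving a bound for the sum of squares free of
        \<open>c\<close>.\<close>
      then have "(\<mu> + 2) / c * Sn X n \<omega> < (\<Sum>i=1..n. (X i \<omega>)\<^sup>2)"
        using Sn_pos by (simp add: Tn_def not_le less_divide_eq)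
      moreover have "(\<mu> + 2) / c * (c * n) \<le> (\<mu> + 2) / c * Sn X n \<omega>"
        using S c \<mu> by (intro mult_left_mono) auto
      ultimately have V: "(\<mu> + 2) * n < (\<Sum>i=1..n. (X i \<omega>)\<^sup>2)"
        using c by simp
      have "Mn X n \<omega> ^ (p + 2) \<le> 0 + (\<Sum>i=1..n. ?B i)"
      proof (rule Mn_power_le[OF B])
        fix i assume i: "i \<in> {1..n}" "Mn X n \<omega> = X i \<omega>"
        define W where "W = (\<Sum>j\<in>{1..n} - {i}. (X j \<omega>)\<^sup>2 - \<mu>)"
        have "(\<Sum>j=1..n. (X j \<omega>)\<^sup>2 - \<mu>) = (X i \<omega>)\<^sup>2 - \<mu> + W"
          unfolding W_def using i by (intro sum.remove) auto
        then have "2 * n < (X i \<omega>)\<^sup>2 - \<mu> + W"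
          using V by (simp add: sum_subtractf algebra_simps)
        \<comment> \<open>The 2 in \<open>\<mu> + 2\<close> leaves a surplus \<open>2 * n\<close>,
          one \<open>n\<close> for each alternative; \<open>- \<mu>\<close> is dropped because
          \<open>\<mu> \<ge> 0\<close>.\<close>
        then consider "n < (X i \<omega>)\<^sup>2" | "n < W" using \<mu> by linarith
        then have "X i \<omega> ^ (p + 2) \<le> ?B i"
        proof cases
          case 1
          then have "sqrt n \<le> X i \<omega>" by (intro real_le_lsqrt) auto
          then have "X i \<omega> ^ (p + 2) \<le> X i \<omega> ^ (p + 2 + k) / sqrt n ^ k"
            using n by (intro power_le_power_divide) auto
          then show ?thesis by (simp add: add_increasing2)
        next
          case 2
          then have "(real n)\<^sup>2 \<le> W\<^sup>2" by (intro power_mono) auto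
          then have "X i \<omega> ^ (p + 2) * (real n)\<^sup>2 \<le> X i \<omega> ^ (p + 2) * W\<^sup>2"
            by (intro mult_left_mono) auto
          then have "X i \<omega> ^ (p + 2) \<le> X i \<omega> ^ (p + 2) * W\<^sup>2 / (real n)\<^sup>2"
            using n by (simp add: le_divide_eq)
          then show ?thesis unfolding W_def by (rule add_increasing[rotated]) simp
        qed
        then show "Mn X n \<omega> ^ (p + 2) \<le> 0 + ?B i" using i by simp
      qed
      moreover have "Tn X n \<omega> ^ p * (Mn X n \<omega>)\<^sup>2 \<le> Mn X n \<omega> ^ (p + 2)"
        unfolding power_add using Tn_le_Mn by (intro mult_right_mono power_mono) auto
      ultimately show ?thesis using A by linarith
    qed
    then have "Rn p X n \<omega> \<le> (?A + (\<Sum>i=1..n. ?B i)) / (c * n)"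
      unfolding Rn_def using S c n A sum_nonneg[of "{1..n}" ?B, OF B]
      by (intro frac_le) auto
    then show ?thesis using C sum_nonneg[of "{1..n}" ?D, OF D] by linarith
  qed
qed

end

section \<open>Moments of lower order and second moments of independent sums\<close>

lemma abs_power_le_power_add_one:
  fixes x :: real
  assumes "m \<le> l"
  shows "\<bar>x ^ m\<bar> \<le> \<bar>x ^ l\<bar> + 1"
proof (cases "\<bar>x\<bar> \<le> 1")
  case True
  then have "\<bar>x\<bar> ^ m \<le> 1" by (intro power_le_one) auto
  then show ?thesis by (simp add: power_abs add_increasing)
next
  case False
  then have "\<bar>x\<bar> ^ m \<le> \<bar>x\<bar> ^ l" using assms by (intro power_increasing) auto
  then show ?thesis by (simp add: power_abs)
qed

lemma (in prob_space) integrable_power_le: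
  fixes Y :: "'a \<Rightarrow> real"
  assumes "integrable M (\<lambda>\<omega>. Y \<omega> ^ l)" "m \<le> l" "Y \<in> borel_measurable M"
  shows "integrable M (\<lambda>\<omega>. Y \<omega> ^ m)"
proof (rule Bochner_Integration.integrable_bound)
  show "integrable M (\<lambda>\<omega>. \<bar>Y \<omega> ^ l\<bar> + 1)" using assms(1) by simp
  show "(\<lambda>\<omega>. Y \<omega> ^ m) \<in> borel_measurable M" using assms(3) by simp
  show "AE \<omega> in M. norm (Y \<omega> ^ m) \<le> norm (\<bar>Y \<omega> ^ l\<bar> + 1)"
    using abs_power_le_power_add_one[OF assms(2)] by (auto simp: abs_of_nonneg)
qed

text \<open>Induction on the index set: the new variable is independent of the sum of the others, so
  the cross term has expectation zero because the variables are centred.\<close>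

lemma (in prob_space) second_moment_indep_sum:
  fixes Y :: "'i \<Rightarrow> 'a \<Rightarrow> real"
  assumes "finite I" "indep_vars (\<lambda>_. borel) Y I"
    and "\<And>i. i \<in> I \<Longrightarrow> integrable M (\<lambda>\<omega>. (Y i \<omega>)\<^sup>2)"
    and "\<And>i. i \<in> I \<Longrightarrow> expectation (Y i) = 0"
  shows "integrable M (\<lambda>\<omega>. (\<Sum>i\<in>I. Y i \<omega>)\<^sup>2)"
    and "expectation (\<lambda>\<omega>. (\<Sum>i\<in>I. Y i \<omega>)\<^sup>2) = (\<Sum>i\<in>I. expectation (\<lambda>\<omega>. (Y i \<omega>)\<^sup>2))"
proof -
  have "integrable M (\<lambda>\<omega>. (\<Sum>i\<in>I. Y i \<omega>)\<^sup>2) \<and>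
    expectation (\<lambda>\<omega>. (\<Sum>i\<in>I. Y i \<omega>)\<^sup>2) = (\<Sum>i\<in>I. expectation (\<lambda>\<omega>. (Y i \<omega>)\<^sup>2))"
    using assms
  proof (induction I rule: finite_induct)
    case (insert i I)
    have meas: "Y j \<in> borel_measurable M" if "j \<in> insert i I" for j
      using insert.prems(1) that by (auto simp: indep_vars_def)
    have int: "integrable M (Y j)" if "j \<in> insert i I" for j
      using integrable_power_le[OF insert.prems(2)[OF that], of 1] meas that by simp
    have IH: "integrable M (\<lambda>\<omega>. (\<Sum>i\<in>I. Y i \<omega>)\<^sup>2)"
      "expectation (\<lambda>\<omega>. (\<Sum>i\<in>I. Y i \<omega>)\<^sup>2) = (\<Sum>i\<in>I. expectation (\<lambda>\<omega>. (Y i \<omega>)\<^sup>2))"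
      using insert.IH insert.prems indep_vars_subset[OF insert.prems(1), of I] by auto
    have ind: "indep_var borel (Y i) borel (\<lambda>\<omega>. \<Sum>j\<in>I. Y j \<omega>)"
      using insert.hyps insert.prems(1) by (intro indep_vars_sum)
    have intS: "integrable M (\<lambda>\<omega>. \<Sum>j\<in>I. Y j \<omega>)" using int by auto
    have eq: "(\<Sum>j\<in>insert i I. Y j \<omega>)\<^sup>2 =
        (Y i \<omega>)\<^sup>2 + 2 * (Y i \<omega> * (\<Sum>j\<in>I. Y j \<omega>)) + (\<Sum>j\<in>I. Y j \<omega>)\<^sup>2" for \<omega>
      using insert.hyps by (simp add: power2_sum)
    have cross: "integrable M (\<lambda>\<omega>. Y i \<omega> * (\<Sum>j\<in>I. Y j \<omega>))"
      "expectation (\<lambda>\<omega>. Y i \<omega> * (\<Sum>j\<in>I. Y j \<omega>)) = 0"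
      using indep_var_integrable[OF ind int intS] indep_var_lebesgue_integral[OF ind int intS]
        insert.prems(3)[of i] by auto
    note sq = insert.prems(2)[of i, simplified]
    show ?case
      unfolding eq using insert.hyps sq cross IH by simp
  qed simp
  then show "integrable M (\<lambda>\<omega>. (\<Sum>i\<in>I. Y i \<omega>)\<^sup>2)"
    "expectation (\<lambda>\<omega>. (\<Sum>i\<in>I. Y i \<omega>)\<^sup>2) = (\<Sum>i\<in>I. expectation (\<lambda>\<omega>. (Y i \<omega>)\<^sup>2))"
    by auto
qed

section \<open>Independent, identically distributed, almost surely positive variables\<close>

locale iid_positive = prob_space M for M :: "'a measure" +
  fixes X :: "nat \<Rightarrow> 'a \<Rightarrow> real"
  assumes rv[measurable]: "\<And>i. X i \<in> borel_measurable M"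
    and indep: "indep_vars (\<lambda>_. borel) X UNIV"
    and ident: "\<And>i. distr M borel (X i) = distr M borel (X 0)"
    and pos: "\<And>i. AE \<omega> in M. X i \<omega> > 0"
begin

lemma expectation_ident:
  fixes f :: "real \<Rightarrow> real"
  assumes "f \<in> borel_measurable borel"
  shows "expectation (\<lambda>\<omega>. f (X i \<omega>)) = expectation (\<lambda>\<omega>. f (X 0 \<omega>))"
  using integral_distr[OF rv assms, of i] integral_distr[OF rv assms, of 0] by (simp add: ident[of i])

lemma integrable_ident:
  fixes f :: "real \<Rightarrow> real"
  assumes "f \<in> borel_measurable borel" "integrable M (\<lambda>\<omega>. f (X 0 \<omega>))"
  shows "integrable M (\<lambda>\<omega>. f (X i \<omega>))"
  using integrable_distr_eq[OF rv assms(1), of i] integrable_distr_eq[OF rv assms(1), of 0] assms(2)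
  by (simp add: ident[of i])

lemma all_pos: "AE \<omega> in M. \<forall>i. X i \<omega> > 0"
  using pos by (simp add: AE_all_countable)

lemma measurable_Mn[measurable]: "Mn X n \<in> borel_measurable M"
  unfolding Mn_def by measurable

lemma measurable_Rn[measurable]: "Rn p X n \<in> borel_measurable M"
  unfolding Rn_def Tn_def Sn_def by measurable

text \<open>By independence the expectation is the \<open>n\<close>-th power of \<open>r\<close> = E
  exp (-X), and 0 < \<open>r\<close> < 1 by positivity of X. The factor 2 leaves room for a Chernoff
  bound: multiplication by \<open>exp (c * n)\<close> still leaves
  \<open>exp (- c * n)\<close>.\<close>

lemma exp_neg_Sn:
  obtains c :: real where "c > 0" "\<And>n. integrable M (\<lambda>\<omega>. exp (- Sn X n \<omega>))"
    "\<And>n. expectation (\<lambda>\<omega>. exp (- Sn X n \<omega>)) = exp (- 2 * c * n)"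
proof -
  have int0: "integrable M (\<lambda>\<omega>. exp (- X 0 \<omega>))"
    using pos[of 0] by (intro integrable_const_bound[where B = 1]) auto
  have int: "integrable M (\<lambda>\<omega>. exp (- X i \<omega>))" for i
    by (rule integrable_ident[OF _ int0]) simp
  define r where "r = expectation (\<lambda>\<omega>. exp (- X 0 \<omega>))"
  have eq: "expectation (\<lambda>\<omega>. exp (- X i \<omega>)) = r" for i
    unfolding r_def by (rule expectation_ident) simp
  have r: "0 < r" "r < 1"
    unfolding r_def using int0 pos[of 0]
    by (auto intro!: expectation_less expectation_greater)
  have ind: "indep_vars (\<lambda>_. borel) (\<lambda>i \<omega>. exp (- X i \<omega>)) {1..n}" for n :: nat
    by (intro indep_vars_compose2[OF indep_vars_subset[OF indep]]) auto
  have exp_eq: "exp (- Sn X n \<omega>) = (\<Prod>i=1..n. exp (- X i \<omega>))" for n \<omega>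
    by (simp add: Sn_def sum_negf[symmetric] exp_sum)
  have "expectation (\<lambda>\<omega>. exp (- Sn X n \<omega>)) = r ^ n" for n
    unfolding exp_eq using indep_vars_lebesgue_integral[OF _ ind int, of n]
    by (simp add: eq)
  moreover have "r ^ n = exp (- 2 * (- ln r / 2) * n)" for n
    using r by (simp add: powr_realpow[symmetric] powr_def mult.commute)
  moreover have "integrable M (\<lambda>\<omega>. exp (- Sn X n \<omega>))" for n
    unfolding exp_eq using indep_vars_integrable[OF _ ind int, of n] by simp
  moreover have "- ln r / 2 > 0" using r by simp
  ultimately show ?thesis using that[of "- ln r / 2"] by auto
qed

text \<open>Since \<open>i \<notin> J\<close>, the two factors are independent and the expectation
  splits; the second moment of the centred sum is then additive. The fourth moment of X makes
  \<open>\<sigma>\<close> finite.\<close>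

lemma power_times_centered_square:
  fixes f :: "real \<Rightarrow> real" and \<mu> \<sigma> :: real
  defines "\<sigma> \<equiv> expectation (\<lambda>\<omega>. ((X 0 \<omega>)\<^sup>2 - \<mu>)\<^sup>2)"
  assumes f[measurable]: "f \<in> borel_measurable borel"
    and intf: "integrable M (\<lambda>\<omega>. f (X 0 \<omega>))" and int4: "integrable M (\<lambda>\<omega>. X 0 \<omega> ^ 4)"
    and \<mu>: "\<mu> = expectation (\<lambda>\<omega>. (X 0 \<omega>)\<^sup>2)"
    and J: "finite J" "i \<notin> J"
  shows "integrable M (\<lambda>\<omega>. f (X i \<omega>) * (\<Sum>j\<in>J. (X j \<omega>)\<^sup>2 - \<mu>)\<^sup>2)"
    and "expectation (\<lambda>\<omega>. f (X i \<omega>) * (\<Sum>j\<in>J. (X j \<omega>)\<^sup>2 - \<mu>)\<^sup>2)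
      = expectation (\<lambda>\<omega>. f (X 0 \<omega>)) * (card J * \<sigma>)"
proof -
  have int2: "integrable M (\<lambda>\<omega>. (X 0 \<omega>)\<^sup>2)"
    by (rule integrable_power_le[OF int4]) auto
  have "((X 0 \<omega>)\<^sup>2 - \<mu>)\<^sup>2 = X 0 \<omega> ^ 4 - 2 * \<mu> * (X 0 \<omega>)\<^sup>2 + \<mu>\<^sup>2" for \<omega>
    by (simp add: power2_diff power_mult[symmetric])
  then have "integrable M (\<lambda>\<omega>. ((X 0 \<omega>)\<^sup>2 - \<mu>)\<^sup>2)"
    using int2 int4 by simp
  from integrable_ident[OF _ this] have intsq: "integrable M (\<lambda>\<omega>. ((X j \<omega>)\<^sup>2 - \<mu>)\<^sup>2)" for j
    by simp
  have sigma: "expectation (\<lambda>\<omega>. ((X j \<omega>)\<^sup>2 - \<mu>)\<^sup>2) = \<sigma>" for j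
    unfolding \<sigma>_def by (rule expectation_ident) simp
  have "expectation (\<lambda>\<omega>. (X 0 \<omega>)\<^sup>2 - \<mu>) = 0"
    using int2 \<mu> by (simp add: prob_space)
  then have mean: "expectation (\<lambda>\<omega>. (X j \<omega>)\<^sup>2 - \<mu>) = 0" for j
    by (subst expectation_ident[where f = "\<lambda>x. x\<^sup>2 - \<mu>"]) auto
  have "indep_vars (\<lambda>_. borel) (\<lambda>j \<omega>. (X j \<omega>)\<^sup>2 - \<mu>) J"
    by (intro indep_vars_compose2[OF indep_vars_subset[OF indep]]) auto
  note S = second_moment_indep_sum[OF J(1) this intsq mean]
  \<comment> \<open>One family that applies \<open>f\<close> at \<open>i\<close> and centred squares
    elsewhere, so that independence of \<open>f (X i \<omega>)\<close> from the whole sum over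
    \<open>J\<close> follows from independence of a single family.\<close>
  define Y where "Y j \<omega> = (if j = i then f (X j \<omega>) else (X j \<omega>)\<^sup>2 - \<mu>)" for j \<omega>
  have "indep_vars (\<lambda>_. borel) (\<lambda>j \<omega>. (if j = i then f else (\<lambda>x. x\<^sup>2 - \<mu>)) (X j \<omega>)) (insert i J)"
    by (intro indep_vars_compose2[OF indep_vars_subset[OF indep]]) auto
  also have "(\<lambda>j \<omega>. (if j = i then f else (\<lambda>x. x\<^sup>2 - \<mu>)) (X j \<omega>)) = Y"
    by (auto simp: Y_def fun_eq_iff)
  finally have "indep_var borel (Y i) borel (\<lambda>\<omega>. \<Sum>j\<in>J. Y j \<omega>)"
    by (intro indep_vars_sum J)
  also have "Y i = (\<lambda>\<omega>. f (X i \<omega>))" by (simp add: Y_def fun_eq_iff)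
  also have "(\<lambda>\<omega>. \<Sum>j\<in>J. Y j \<omega>) = (\<lambda>\<omega>. \<Sum>j\<in>J. (X j \<omega>)\<^sup>2 - \<mu>)"
    using J by (intro ext sum.cong) (auto simp: Y_def)
  finally have "indep_var borel (id \<circ> (\<lambda>\<omega>. f (X i \<omega>)))
      borel ((\<lambda>x. x\<^sup>2) \<circ> (\<lambda>\<omega>. \<Sum>j\<in>J. (X j \<omega>)\<^sup>2 - \<mu>))"
    by (rule indep_var_compose) auto
  then have ind: "indep_var borel (\<lambda>\<omega>. f (X i \<omega>)) borel (\<lambda>\<omega>. (\<Sum>j\<in>J. (X j \<omega>)\<^sup>2 - \<mu>)\<^sup>2)"
    by (simp add: comp_def)
  note intfi = integrable_ident[OF f intf, of i]
  show "integrable M (\<lambda>\<omega>. f (X i \<omega>) * (\<Sum>j\<in>J. (X j \<omega>)\<^sup>2 - \<mu>)\<^sup>2)"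
    by (rule indep_var_integrable[OF ind intfi S(1)])
  show "expectation (\<lambda>\<omega>. f (X i \<omega>) * (\<Sum>j\<in>J. (X j \<omega>)\<^sup>2 - \<mu>)\<^sup>2)
      = expectation (\<lambda>\<omega>. f (X 0 \<omega>)) * (card J * \<sigma>)"
    unfolding indep_var_lebesgue_integral[OF ind intfi S(1)] S(2) expectation_ident[OF f, of i]
    by (simp add: sigma)
qed

text \<open>Truncation at level \<open>a\<close>: below it the square of the maximum is at most
  \<open>a\<^sup>2\<close>, above it \<open>h\<close> at the maximising index dominates. The choice
  of \<open>h\<close> adapts the bound to power or exponential moments.\<close>

lemma expectation_Mn_square_le:
  fixes h :: "real \<Rightarrow> real"
  assumes h[measurable]: "h \<in> borel_measurable borel" and int: "integrable M (\<lambda>\<omega>. h (X 0 \<omega>))"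
    and h0: "\<And>x. x > 0 \<Longrightarrow> h x \<ge> 0" and h2: "\<And>x. x > a \<Longrightarrow> x\<^sup>2 \<le> h x" and n: "n \<ge> 1"
  shows "integrable M (\<lambda>\<omega>. (Mn X n \<omega>)\<^sup>2)"
    and "expectation (\<lambda>\<omega>. (Mn X n \<omega>)\<^sup>2) \<le> a\<^sup>2 + n * expectation (\<lambda>\<omega>. h (X 0 \<omega>))"
proof -
  have *: "(Mn X n \<omega>)\<^sup>2 \<le> a\<^sup>2 + (\<Sum>i=1..n. h (X i \<omega>))" if "\<forall>i. X i \<omega> > 0" for \<omega>
  proof -
    have "(Mn X n \<omega>)\<^sup>2 \<le> a\<^sup>2 + h (X i \<omega>)" if "Mn X n \<omega> = X i \<omega>" for i
      using h2[of "X i \<omega>"] h0[of "X i \<omega>"] \<open>\<forall>i. X i \<omega> > 0\<close> that power_mono[of "X i \<omega>" a 2]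
      by (cases "X i \<omega> > a") (auto simp: add_increasing add_increasing2 less_imp_le)
    then show ?thesis
      using that by (intro Mn_power_le[OF n]) (auto intro: h0)
  qed
  note inth = integrable_ident[OF h int]
  have I: "integrable M (\<lambda>\<omega>. a\<^sup>2 + (\<Sum>i=1..n. h (X i \<omega>)))" using inth by auto
  show int2: "integrable M (\<lambda>\<omega>. (Mn X n \<omega>)\<^sup>2)"
    by (rule Bochner_Integration.integrable_bound[OF I])
      (use all_pos in \<open>auto elim!: eventually_mono dest!: *\<close>)
  have "expectation (\<lambda>\<omega>. (Mn X n \<omega>)\<^sup>2) \<le> expectation (\<lambda>\<omega>. a\<^sup>2 + (\<Sum>i=1..n. h (X i \<omega>)))"
    using all_pos * by (intro integral_mono_AE int2 I) (auto elim!: eventually_mono)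
  also have "\<dots> = a\<^sup>2 + n * expectation (\<lambda>\<omega>. h (X 0 \<omega>))"
    using inth by (simp add: prob_space) (simp add: expectation_ident[OF h, THEN sum.cong[OF refl]])
  finally show "expectation (\<lambda>\<omega>. (Mn X n \<omega>)\<^sup>2) \<le> a\<^sup>2 + n * expectation (\<lambda>\<omega>. h (X 0 \<omega>))" .
qed

end

section \<open>From a tail bound to finite moments\<close>

text \<open>Where \<open>Y\<close> lies between \<open>2 ^ j\<close> and \<open>2 ^ (j + 1)\<close>,
  its power is at most \<open>2 ^ ((j + 1) * q)\<close>, while the tail bound makes the probability
  of order \<open>2 powr (- s * j)\<close>. The resulting series is geometric.\<close>

lemma (in prob_space) integrable_power_if_tail:
  fixes Y :: "'a \<Rightarrow> real" and q :: nat and s :: real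
  assumes [measurable]: "Y \<in> borel_measurable M" and pos: "AE \<omega> in M. Y \<omega> > 0"
    and tail: "(\<lambda>x. measure M {\<omega> \<in> space M. Y \<omega> \<ge> x}) \<in> O(\<lambda>x::real. x powr (- s))"
    and "q < s"
  shows "integrable M (\<lambda>\<omega>. Y \<omega> ^ q)"
proof (rule integrableI_nonneg)
  obtain c where c: "c > 0"
    "eventually (\<lambda>x. norm (measure M {\<omega> \<in> space M. Y \<omega> \<ge> x}) \<le> c * norm (x powr (- s))) at_top"
    using landau_o.bigE[OF tail] by blast
  then obtain x0 where x0: "\<And>x. x \<ge> x0 \<Longrightarrow> measure M {\<omega> \<in> space M. Y \<omega> \<ge> x} \<le> c * x powr (- s)"
    by (auto simp: eventually_at_top_linorder)
  \<comment> \<open>Above \<open>2 ^ k0\<close>, the power is bounded by a sum over the dyadic events \<open>A k\<close>.\<close>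
  obtain k0 where k0: "x0 < 2 ^ k0"
    using real_arch_pow[of 2 x0] by auto
  define A where "A k = {\<omega> \<in> space M. Y \<omega> \<ge> 2 ^ (k + k0)}" for k
  have [measurable]: "A k \<in> sets M" for k
    unfolding A_def by measurable
  \<comment> \<open>The ratio of the dyadic series; it equals \<open>2 powr (q - s)\<close>, below 1
    because \<open>q < s\<close>.\<close>
  define r :: real where "r = 2 ^ q * 2 powr (- s)"
  have r: "0 \<le> r" "r < 1"
    using \<open>q < s\<close> powr_less_mono[of "real q - s" 0 2]
    by (auto simp: r_def powr_realpow[symmetric] powr_add[symmetric])
  have term_le: "2 ^ ((k + k0 + 1) * q) * measure M (A k) \<le> c * 2 ^ q * r ^ (k + k0)" for k
  proof -
    have "(2::real) ^ k0 \<le> 2 ^ (k + k0)" by (intro power_increasing) auto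
    then have "measure M (A k) \<le> c * (2 ^ (k + k0)) powr (- s)"
      unfolding A_def using k0 by (intro x0) linarith
    also have "((2::real) ^ (k + k0)) powr (- s) = (2 powr (- s)) ^ (k + k0)"
      by (simp add: powr_realpow[symmetric] powr_powr powr_power mult.commute)
    finally have "2 ^ ((k + k0 + 1) * q) * measure M (A k)
        \<le> 2 ^ ((k + k0 + 1) * q) * (c * (2 powr (- s)) ^ (k + k0))"
      by (intro mult_left_mono) auto
    also have "\<dots> = c * 2 ^ q * r ^ (k + k0)"
      by (simp add: r_def power_mult_distrib power_add power_mult[symmetric] algebra_simps)
    finally show ?thesis .
  qed
  have le: "ennreal (Y \<omega> ^ q)
      \<le> ennreal (2 ^ (k0 * q)) + (\<Sum>k. ennreal (2 ^ ((k + k0 + 1) * q)) * indicator (A k) \<omega>)"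
    if "Y \<omega> > 0" "\<omega> \<in> space M" for \<omega>
  proof (cases "Y \<omega> \<le> 2 ^ k0")
    case True
    then have "Y \<omega> ^ q \<le> (2 ^ k0) ^ q" using that by (intro power_mono) auto
    then have "ennreal (Y \<omega> ^ q) \<le> ennreal (2 ^ (k0 * q))"
      by (intro ennreal_leI) (simp add: power_mult)
    then show ?thesis
      by (rule order_trans) (rule add_increasing2[OF zero_le order_refl])
  next
    case False
    have "\<exists>m. Y \<omega> < 2 ^ m"
      by (rule real_arch_pow) simp
    then obtain m where m: "Y \<omega> < 2 ^ m" and least: "\<And>i. i < m \<Longrightarrow> \<not> Y \<omega> < 2 ^ i"
      unfolding exists_least_iff[of "\<lambda>m. Y \<omega> < 2 ^ m"] by blast
    have "k0 < m"
    proof (rule ccontr)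
      assume "\<not> k0 < m"
      then have "(2::real) ^ m \<le> 2 ^ k0" by (intro power_increasing) auto
      with m False show False by linarith
    qed
    \<comment> \<open>With \<open>m\<close> the least exponent above,
      \<open>2 ^ (k + k0) \<le> Y \<omega> < 2 ^ (k + k0 + 1)\<close>: the event \<open>A k\<close>
      occurs and its single term already dominates the power.\<close>
    define k where "k = m - 1 - k0"
    have mk: "m = Suc (k + k0)" using \<open>k0 < m\<close> by (simp add: k_def)
    have "\<not> Y \<omega> < 2 ^ (k + k0)"
      using mk by (intro least) simp
    then have "\<omega> \<in> A k" using that by (simp add: A_def)
    have "Y \<omega> ^ q \<le> (2 ^ (k + k0 + 1)) ^ q"
      using m mk that by (intro power_mono) auto
    then have "ennreal (Y \<omega> ^ q) \<le> ennreal (2 ^ ((k + k0 + 1) * q)) * indicator (A k) \<omega>"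
      using \<open>\<omega> \<in> A k\<close> by (simp add: power_mult[symmetric] ennreal_leI del: power_Suc)
    also have "\<dots> = (\<Sum>k\<in>{k}. ennreal (2 ^ ((k + k0 + 1) * q)) * indicator (A k) \<omega>)"
      by (simp only: sum.insert finite.emptyI sum.empty empty_iff not_False_eq_True add_0_right)
    also have "\<dots> \<le> (\<Sum>k. ennreal (2 ^ ((k + k0 + 1) * q)) * indicator (A k) \<omega>)"
      by (intro sum_le_suminf) auto
    finally show ?thesis by (rule add_increasing[OF zero_le])
  qed
  have "(\<integral>\<^sup>+\<omega>. ennreal (Y \<omega> ^ q) \<partial>M)
      \<le> (\<integral>\<^sup>+\<omega>. ennreal (2 ^ (k0 * q)) + (\<Sum>k. ennreal (2 ^ ((k + k0 + 1) * q)) * indicator (A k) \<omega>) \<partial>M)"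
  proof (rule nn_integral_mono_AE)
    show "AE \<omega> in M. ennreal (Y \<omega> ^ q)
        \<le> ennreal (2 ^ (k0 * q)) + (\<Sum>k. ennreal (2 ^ ((k + k0 + 1) * q)) * indicator (A k) \<omega>)"
      using pos AE_space by eventually_elim (rule le)
  qed
  also have "\<dots> = ennreal (2 ^ (k0 * q)) + (\<Sum>k. ennreal (2 ^ ((k + k0 + 1) * q)) * emeasure M (A k))"
    by (simp add: nn_integral_add nn_integral_suminf nn_integral_cmult_indicator emeasure_space_1)
  also have "(\<Sum>k. ennreal (2 ^ ((k + k0 + 1) * q)) * emeasure M (A k))
      \<le> (\<Sum>k. ennreal (c * 2 ^ q * r ^ (k + k0)))"
    by (intro suminf_le)
      (auto simp: emeasure_eq_measure ennreal_mult[symmetric] intro!: ennreal_leI term_le[simplified])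
  also have "\<dots> < \<infinity>"
  proof -
    have "summable (\<lambda>k. c * 2 ^ q * r ^ (k + k0))"
      using r by (intro summable_mult) (auto simp: summable_iff_shift summable_geometric)
    then have "(\<Sum>k. ennreal (c * 2 ^ q * r ^ (k + k0))) \<noteq> top"
      using r c by (intro ennreal_suminf_neq_top) auto
    then show ?thesis by (simp add: less_top)
  qed
  finally show "(\<integral>\<^sup>+\<omega>. ennreal (Y \<omega> ^ q) \<partial>M) < \<infinity>"
    by (simp add: add_left_mono)
  show "AE \<omega> in M. 0 \<le> Y \<omega> ^ q" using pos by (auto elim!: eventually_mono)
qed measurable

section \<open>Bounds for the expectations of R_n and of the squared maximum\<close>

context iid_positive
begin

text \<open>The pathwise bound is integrated term by term. By independence the squared centred sum
  contributes its variance, of order \<open>n\<close>, and \<open>k \<ge> 1\<close> provides the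
  moment of order \<open>p + 3\<close>.\<close>

lemma expectation_Rn_le:
  fixes p k :: nat
  assumes p: "p \<ge> 2" and k: "k \<ge> 1" and int: "integrable M (\<lambda>\<omega>. X 0 \<omega> ^ (p + 2 + k))"
  obtains C where "C \<ge> 0" "\<And>n. n \<ge> 1 \<Longrightarrow> integrable M (Rn p X n)"
    "\<And>n. n \<ge> 1 \<Longrightarrow> expectation (Rn p X n)
      \<le> C * (expectation (\<lambda>\<omega>. (Mn X n \<omega>)\<^sup>2) / n + 1 / sqrt n ^ k + 1 / n)"
proof -
  define m where "m j = expectation (\<lambda>\<omega>. X 0 \<omega> ^ j)" for j
  define \<mu> where "\<mu> = expectation (\<lambda>\<omega>. (X 0 \<omega>)\<^sup>2)"
  define \<sigma> where "\<sigma> = expectation (\<lambda>\<omega>. ((X 0 \<omega>)\<^sup>2 - \<mu>)\<^sup>2)"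
  obtain c where c: "c > 0" "\<And>n. integrable M (\<lambda>\<omega>. exp (- Sn X n \<omega>))"
    "\<And>n. expectation (\<lambda>\<omega>. exp (- Sn X n \<omega>)) = exp (- 2 * c * n)"
    using exp_neg_Sn by blast
  have int0: "integrable M (\<lambda>\<omega>. X 0 \<omega> ^ j)" if "j \<le> p + 2 + k" for j
    using that by (intro integrable_power_le[OF int]) auto
  have intX: "integrable M (\<lambda>\<omega>. X i \<omega> ^ j)" if "j \<le> p + 2 + k" for i j
    by (rule integrable_ident[OF _ int0[OF that]]) simp
  have mX: "expectation (\<lambda>\<omega>. X i \<omega> ^ j) = m j" for i j
    unfolding m_def by (rule expectation_ident) simp
  have m0: "m j \<ge> 0" for j
    unfolding m_def using pos[of 0] by (intro integral_nonneg_AE) (auto elim!: eventually_mono)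
  have \<mu>0: "\<mu> \<ge> 0" and \<sigma>0: "\<sigma> \<ge> 0" by (auto simp: \<mu>_def \<sigma>_def)
  define K where "K = ((\<mu> + 2) / c) ^ p"
  have K0: "K \<ge> 0" using \<mu>0 c by (simp add: K_def)
  \<comment> \<open>Chosen from \<open>(c * n) ^ (p + 2) \<le> fact (p + 2) * exp (c * n)\<close>,
    so that \<open>n ^ (p + 1) * exp (- c * n)\<close> is at most \<open>F / n\<close>.\<close>
  define F :: real where "F = fact (p + 2) / c ^ (p + 2)"
  have F0: "F \<ge> 0" using c by (simp add: F_def)
  \<comment> \<open>The sum of the coefficients of the three error terms, the last bracket belonging
    to \<open>1 / n\<close>. All are nonnegative, so \<open>C\<close> dominates each one
    separately.\<close>
  define C where "C = K / c + m (p + 2 + k) / c + (m (p + 2) * \<sigma> / c + F + m (p + 3))"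
  have main: "integrable M (Rn p X n) \<and> expectation (Rn p X n)
      \<le> C * (expectation (\<lambda>\<omega>. (Mn X n \<omega>)\<^sup>2) / n + 1 / sqrt n ^ k + 1 / n)"
    if n: "n \<ge> 1" for n :: nat
  proof -
    define W where "W i \<omega> = (\<Sum>j\<in>{1..n} - {i}. (X j \<omega>)\<^sup>2 - \<mu>)" for i \<omega>
    define d1 d2 d3 where d: "d1 = p + 2 + k" "d2 = p + 2" "d3 = p + 3"
    define B where "B \<omega> = (K * (Mn X n \<omega>)\<^sup>2
       + (\<Sum>i=1..n. X i \<omega> ^ d1 / sqrt n ^ k
            + X i \<omega> ^ d2 * (W i \<omega>)\<^sup>2 / (real n)\<^sup>2)) / (c * n)
      + (real n ^ (p + 1) * exp (c * n) * exp (- Sn X n \<omega>)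
         + (\<Sum>i=1..n. X i \<omega> ^ d3 / (real n)\<^sup>2))" for \<omega>
    \<comment> \<open>Truncation at level 0 with the square itself as \<open>h\<close>; only
      integrability is wanted here.\<close>
    have intM: "integrable M (\<lambda>\<omega>. (Mn X n \<omega>)\<^sup>2)"
      by (rule expectation_Mn_square_le(1)[OF _ int0[of 2] _ _ n, of 0]) auto
    have intd: "integrable M (\<lambda>\<omega>. X i \<omega> ^ d1)" "integrable M (\<lambda>\<omega>. X i \<omega> ^ d3)" for i
      using k by (intro intX; simp add: d)+
    \<comment> \<open>The fourth moment required here is available because \<open>p \<ge> 2\<close>
      gives \<open>4 \<le> p + 2 + k\<close>.\<close>
    have W: "integrable M (\<lambda>\<omega>. X i \<omega> ^ d2 * (W i \<omega>)\<^sup>2)"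
      "expectation (\<lambda>\<omega>. X i \<omega> ^ d2 * (W i \<omega>)\<^sup>2) = m d2 * ((n - 1) * \<sigma>)"
      if "i \<in> {1..n}" for i
      unfolding W_def m_def \<sigma>_def
      using power_times_centered_square[of "\<lambda>x. x ^ d2" \<mu> "{1..n} - {i}" i]
        int0[of 4] int0[of d2] p k that
      by (auto simp: \<mu>_def d(2))
    have "has_bochner_integral M B ((K * expectation (\<lambda>\<omega>. (Mn X n \<omega>)\<^sup>2)
       + (\<Sum>i=1..n. m d1 / sqrt n ^ k + m d2 * ((n - 1) * \<sigma>) / (real n)\<^sup>2)) / (c * n)
      + (real n ^ (p + 1) * exp (c * n) * exp (- 2 * c * n) + (\<Sum>i=1..n. m d3 / (real n)\<^sup>2)))"
      unfolding B_def
    proof (intro has_bochner_integral_add has_bochner_integral_divide has_bochner_integral_sum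
        has_bochner_integral_mult_right)
    qed (use intM W intd c mX in \<open>auto simp: has_bochner_integral_iff\<close>)
    then have intB: "integrable M B"
      and "expectation B = (K * expectation (\<lambda>\<omega>. (Mn X n \<omega>)\<^sup>2)
       + (\<Sum>i=1..n. m d1 / sqrt n ^ k + m d2 * ((n - 1) * \<sigma>) / (real n)\<^sup>2)) / (c * n)
      + (real n ^ (p + 1) * exp (c * n) * exp (- 2 * c * n) + (\<Sum>i=1..n. m d3 / (real n)\<^sup>2))"
      by (auto simp only: has_bochner_integral_iff)
    note this(2)
    \<comment> \<open>Each sum has \<open>n\<close> equal terms. This factor cancels the
      \<open>n\<close> in \<open>c * n\<close> in the first part and one power of \<open>n\<close>
      in the last sum.\<close>
    also have "\<dots> = K / c * (expectation (\<lambda>\<omega>. (Mn X n \<omega>)\<^sup>2) / n) + m (p + 2 + k) / c * (1 / sqrt n ^ k)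
        + (m (p + 2) * \<sigma> / c * ((n - 1) / (real n)\<^sup>2) + real n ^ (p + 1) * exp (- c * n) + m (p + 3) * (1 / n))"
    proof -
      have "exp (c * n) * exp (- 2 * c * n) = exp (- c * n)"
        unfolding exp_add[symmetric] by simp
      then show ?thesis
        unfolding d using n c by (simp add: field_simps power2_eq_square del: of_nat_diff)
    qed
    also have "\<dots> \<le> K / c * (expectation (\<lambda>\<omega>. (Mn X n \<omega>)\<^sup>2) / n) + m (p + 2 + k) / c * (1 / sqrt n ^ k)
        + (m (p + 2) * \<sigma> / c * (1 / n) + F * (1 / n) + m (p + 3) * (1 / n))"
    proof -
      have "(n - 1) / (real n)\<^sup>2 \<le> 1 / n"
        using n by (simp add: field_simps power2_eq_square)
      moreover have "real n ^ (p + 1) * exp (- c * n) \<le> F * (1 / n)"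
      proof -
        have "c ^ (p + 2) * (real n ^ (p + 1) * n) \<le> fact (p + 2) * exp (c * n)"
          using power_le_fact_exp[of "c * n" "p + 2"] c by (simp add: power_mult_distrib mult_ac)
        then show ?thesis
          using c n by (simp add: F_def exp_minus field_simps)
      qed
      ultimately show ?thesis
        using m0 \<sigma>0 c by (intro add_mono mult_left_mono order_refl) auto
    qed
    also have "\<dots> = K / c * (expectation (\<lambda>\<omega>. (Mn X n \<omega>)\<^sup>2) / n) + m (p + 2 + k) / c * (1 / sqrt n ^ k)
        + (m (p + 2) * \<sigma> / c + F + m (p + 3)) * (1 / n)"
      by (simp add: add_divide_distrib)
    also have "\<dots> \<le> C * (expectation (\<lambda>\<omega>. (Mn X n \<omega>)\<^sup>2) / n) + C * (1 / sqrt n ^ k) + C * (1 / n)"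
      using K0 c m0 \<sigma>0 F0 by (intro add_mono mult_right_mono) (auto simp: C_def intro!: add_nonneg_nonneg)
    finally have EB: "expectation B
        \<le> C * (expectation (\<lambda>\<omega>. (Mn X n \<omega>)\<^sup>2) / n + 1 / sqrt n ^ k + 1 / n)"
      by (simp only: distrib_left)
    have R: "0 \<le> Rn p X n \<omega>" "Rn p X n \<omega> \<le> B \<omega>" if "\<forall>i. X i \<omega> > 0" for \<omega>
    proof -
      show "0 \<le> Rn p X n \<omega>" using that by (intro Rn_nonneg n) auto
      show "Rn p X n \<omega> \<le> B \<omega>"
        using Rn_le_regimes[OF n, of X \<omega> c \<mu> p k] that c \<mu>0
        by (simp add: B_def W_def K_def d exp_diff exp_minus divide_inverse mult.assoc)
    qed
    have "integrable M (Rn p X n)"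
    proof (rule Bochner_Integration.integrable_bound[OF intB measurable_Rn])
      show "AE \<omega> in M. norm (Rn p X n \<omega>) \<le> norm (B \<omega>)"
        using all_pos by (rule eventually_mono) (use R in force)
    qed
    moreover have "expectation (Rn p X n) \<le> expectation B"
      using all_pos calculation intB by (intro integral_mono_AE) (auto elim!: eventually_mono intro: R)
    ultimately show ?thesis using EB by linarith
  qed
  have "C \<ge> 0"
    unfolding C_def using K0 c m0 \<sigma>0 F0 by (intro add_nonneg_nonneg) auto
  with main show ?thesis using that by blast
qed

text \<open>The level \<open>a = n powr (1 / q)\<close> balances the truncation:
  \<open>a ^ q = n\<close> makes both \<open>a\<^sup>2\<close> and \<open>n / a ^ (q - 2)\<close>
  equal to \<open>n powr (2 / q)\<close>.\<close>

lemma expectation_Mn_square_le_powr: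
  assumes q: "q \<ge> 2" and int: "integrable M (\<lambda>\<omega>. X 0 \<omega> ^ q)" and n: "n \<ge> 1"
  shows "expectation (\<lambda>\<omega>. (Mn X n \<omega>)\<^sup>2) / n
    \<le> (1 + expectation (\<lambda>\<omega>. X 0 \<omega> ^ q)) * n powr (2 / q - 1)"
proof -
  define a where "a = n powr (1 / q)"
  have a: "a > 0" using n by (simp add: a_def)
  have aq: "a ^ q = n" using q n by (simp add: a_def powr_power)
  have a2: "a\<^sup>2 = n powr (2 / q)" using n by (simp add: a_def powr_power)
  have split: "q = 2 + (q - 2)" using q by simp
  have "x\<^sup>2 \<le> x ^ q / a ^ (q - 2)" if "x > a" for x
    using power_le_power_divide[of a x 2 "q - 2", folded split] a that by simp
  then have "expectation (\<lambda>\<omega>. (Mn X n \<omega>)\<^sup>2)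
      \<le> a\<^sup>2 + n * expectation (\<lambda>\<omega>. X 0 \<omega> ^ q / a ^ (q - 2))"
    using a int by (intro expectation_Mn_square_le n) auto
  also have "\<dots> = a\<^sup>2 + n / a ^ (q - 2) * expectation (\<lambda>\<omega>. X 0 \<omega> ^ q)"
    by simp
  also have "n / a ^ (q - 2) = a\<^sup>2"
    using a aq[symmetric] q by (simp add: power_diff)
  finally show ?thesis
    using n by (simp add: a2 powr_diff divide_right_mono field_simps)
qed

text \<open>Above the level \<open>2 * ln n / \<epsilon>\<close> one has
  \<open>exp (\<epsilon> * x / 2) \<ge> n\<close>. Half of the exponential thus pays for the factor
  \<open>n\<close>, and the other half dominates \<open>x\<^sup>2\<close>; the 8 is
  \<open>fact 2\<close> times \<open>2\<^sup>2\<close>.\<close>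

lemma expectation_Mn_square_le_ln:
  assumes \<epsilon>: "\<epsilon> > 0" and int: "integrable M (\<lambda>\<omega>. exp (\<epsilon> * X 0 \<omega>))" and n: "n \<ge> 1"
  shows "expectation (\<lambda>\<omega>. (Mn X n \<omega>)\<^sup>2)
    \<le> (4 * (ln n)\<^sup>2 + 8 * expectation (\<lambda>\<omega>. exp (\<epsilon> * X 0 \<omega>))) / \<epsilon>\<^sup>2"
proof -
  have "x\<^sup>2 \<le> 8 / \<epsilon>\<^sup>2 * exp (\<epsilon> * x) / n" if "x > 2 * ln n / \<epsilon>" for x
  proof -
    have "0 \<le> 2 * ln n / \<epsilon>" using n \<epsilon> by simp
    with that have "x > 0" by linarith
    then have "(\<epsilon> * x / 2)\<^sup>2 \<le> fact 2 * exp (\<epsilon> * x / 2)"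
      using \<epsilon> by (intro power_le_fact_exp) auto
    moreover have "n * exp (\<epsilon> * x / 2) \<le> exp (\<epsilon> * x / 2) * exp (\<epsilon> * x / 2)"
    proof (rule mult_right_mono)
      have "ln n \<le> \<epsilon> * x / 2" using that \<epsilon> by (simp add: field_simps)
      then show "n \<le> exp (\<epsilon> * x / 2)" using n exp_le_cancel_iff[of "ln n"] by simp
    qed simp
    then have "n * exp (\<epsilon> * x / 2) \<le> exp (\<epsilon> * x)"
      unfolding exp_add[symmetric] by simp
    then have "exp (\<epsilon> * x / 2) \<le> exp (\<epsilon> * x) / n"
      using n by (simp add: field_simps)
    ultimately have "(\<epsilon> * x / 2)\<^sup>2 \<le> 2 * (exp (\<epsilon> * x) / n)"
      by (simp add: fact_numeral)
    then show ?thesis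
      using \<epsilon> n by (simp add: field_simps power2_eq_square)
  qed
  then have "expectation (\<lambda>\<omega>. (Mn X n \<omega>)\<^sup>2)
      \<le> (2 * ln n / \<epsilon>)\<^sup>2 + n * expectation (\<lambda>\<omega>. 8 / \<epsilon>\<^sup>2 * exp (\<epsilon> * X 0 \<omega>) / n)"
    using int by (intro expectation_Mn_square_le n) auto
  also have "\<dots> = (4 * (ln n)\<^sup>2 + 8 * expectation (\<lambda>\<omega>. exp (\<epsilon> * X 0 \<omega>))) / \<epsilon>\<^sup>2"
    using n \<epsilon> by (simp add: power_mult_distrib power_divide add_divide_distrib)
  finally show ?thesis .
qed

text \<open>R_n is almost surely nonnegative for \<open>n \<ge> 1\<close>, so an upper bound on its
  expectation also bounds the norm.\<close>

lemma expectation_Rn_bigo: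
  assumes "\<forall>\<^sub>F n in at_top. expectation (Rn p X n) \<le> C * g n" "\<And>n. g n \<ge> 0"
  shows "(\<lambda>n. expectation (Rn p X n)) \<in> O(g)"
proof (rule bigoI)
  show "\<forall>\<^sub>F n in at_top. norm (expectation (Rn p X n)) \<le> C * norm (g n)"
    using assms(1) eventually_ge_at_top[of 1]
  proof eventually_elim
    case (elim n)
    have "AE \<omega> in M. 0 \<le> Rn p X n \<omega>"
      using all_pos elim(2) by (auto elim!: eventually_mono intro!: Rn_nonneg)
    then show ?case using elim assms(2)[of n] by (simp add: integral_nonneg_AE)
  qed
qed

end

section \<open>The three rates\<close>

theorem theorem3:
  fixes M :: "'a measure" and X :: "nat \<Rightarrow> 'a \<Rightarrow> real" and p :: nat
  assumes "prob_space M"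
    and rv: "\<And>i. X i \<in> borel_measurable M"
    and indep: "prob_space.indep_vars M (\<lambda>_. borel) X UNIV"
    and ident: "\<And>i. distr M borel (X i) = distr M borel (X 0)"
    and pos: "\<And>i. AE \<omega> in M. X i \<omega> > 0"
    and p2: "p \<ge> 2"
  shows
    "((\<lambda>x::real. measure M {\<omega> \<in> space M. X 0 \<omega> \<ge> x}) \<in> O(\<lambda>x. x powr (- (real p + 7/2)))
        \<longrightarrow> (\<forall>\<^sub>F n in at_top. integrable M (Rn p X n))
          \<and> (\<lambda>n. integral\<^sup>L M (Rn p X n)) \<in> O(\<lambda>n. real n powr (-1/2)))
   \<and> ((p > 8 \<and> integrable M (\<lambda>\<omega>. (X 0 \<omega>) ^ (p + 4)))
        \<longrightarrow> (\<forall>\<^sub>F n in at_top. integrable M (Rn p X n))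
          \<and> (\<lambda>n. integral\<^sup>L M (Rn p X n))
               \<in> O(\<lambda>n. real n powr (- (real p - 2) / (real p + 4))))
   \<and> ((\<exists>\<epsilon>>0. integrable M (\<lambda>\<omega>. exp (\<epsilon> * X 0 \<omega>)))
        \<longrightarrow> (\<forall>\<^sub>F n in at_top. integrable M (Rn p X n))
          \<and> (\<lambda>n. integral\<^sup>L M (Rn p X n)) \<in> O(\<lambda>n. (ln (real n))^2 / real n))"
proof (intro conjI[of "_ \<longrightarrow> _"] impI)
  interpret prob_space M by fact
  interpret iid_positive M X
    by unfold_locales (use rv indep ident pos in auto)
  define E where "E n = expectation (\<lambda>\<omega>. (Mn X n \<omega>)\<^sup>2)" for n
  {
    assume tail: "(\<lambda>x::real. measure M {\<omega> \<in> space M. X 0 \<omega> \<ge> x}) \<in> O(\<lambda>x. x powr (- (real p + 7/2)))"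
    \<comment> \<open>The tail exponent \<open>p + 7/2\<close> exceeds \<open>p + 3\<close>, which
      gives the moment needed for \<open>k = 1\<close>.\<close>
    have int: "integrable M (\<lambda>\<omega>. X 0 \<omega> ^ (p + 3))"
      by (rule integrable_power_if_tail[OF rv pos tail]) simp
    then have "integrable M (\<lambda>\<omega>. X 0 \<omega> ^ (p + 2 + 1))" by (simp add: numeral_3_eq_3)
    from expectation_Rn_le[OF p2 order_refl this] obtain C where C: "C \<ge> 0"
      "\<And>n. n \<ge> 1 \<Longrightarrow> integrable M (Rn p X n)"
      "\<And>n. n \<ge> 1 \<Longrightarrow> expectation (Rn p X n) \<le> C * (E n / n + 1 / sqrt n ^ 1 + 1 / n)"
      unfolding E_def by blast
    define m where "m = expectation (\<lambda>\<omega>. X 0 \<omega> ^ (p + 3))"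
    have "m \<ge> 0"
      unfolding m_def using pos[of 0] by (intro integral_nonneg_AE) (auto elim!: eventually_mono)
    have "\<forall>\<^sub>F n in at_top. expectation (Rn p X n) \<le> (C * (m + 3)) * real n powr (-1/2)"
      using eventually_ge_at_top[of 1]
    proof eventually_elim
      case (elim n)
      have "E n / n \<le> (1 + m) * n powr (2 / (p + 3) - 1)"
        unfolding E_def m_def using expectation_Mn_square_le_powr[OF _ int elim] by simp
      \<comment> \<open>Here \<open>2 / (p + 3) \<le> 1 / 2\<close> since \<open>p \<ge> 2\<close>.
        The rate is set by the term \<open>1 / sqrt n\<close> coming from
        \<open>k = 1\<close>.\<close>
      also have "\<dots> \<le> (1 + m) * n powr (-1/2)"
        using \<open>m \<ge> 0\<close> elim p2 by (intro mult_left_mono powr_mono) (auto simp: field_simps)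
      finally have "E n / n \<le> (1 + m) * n powr (-1/2)" .
      moreover have "1 / sqrt n ^ 1 = n powr (-1/2)"
        using elim by (simp add: powr_half_sqrt[symmetric] powr_minus_divide)
      moreover have "1 / n \<le> n powr (-1/2)"
        using elim powr_mono[of "-1" "-1/2" "real n"] by (simp add: powr_minus_divide)
      ultimately have "E n / n + 1 / sqrt n ^ 1 + 1 / n \<le> (m + 3) * n powr (-1/2)"
        by (simp add: algebra_simps)
      then show ?case
        using C(3)[OF elim] mult_left_mono[OF _ C(1)] by (fastforce simp: mult.assoc)
    qed
    then show "(\<forall>\<^sub>F n in at_top. integrable M (Rn p X n))
        \<and> (\<lambda>n. integral\<^sup>L M (Rn p X n)) \<in> O(\<lambda>n. real n powr (-1/2))"
      using C(2) by (intro conjI expectation_Rn_bigo) (auto intro: eventually_at_top_linorderI[of 1])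
  next
    assume "p > 8 \<and> integrable M (\<lambda>\<omega>. (X 0 \<omega>) ^ (p + 4))"
    then have int: "integrable M (\<lambda>\<omega>. X 0 \<omega> ^ (p + 4))" by simp
    moreover have "p + 2 + 2 = p + 4" by simp
    ultimately have "integrable M (\<lambda>\<omega>. X 0 \<omega> ^ (p + 2 + 2))" by (simp only:)
    from expectation_Rn_le[OF p2 _ this] obtain C where C: "C \<ge> 0"
      "\<And>n. n \<ge> 1 \<Longrightarrow> integrable M (Rn p X n)"
      "\<And>n. n \<ge> 1 \<Longrightarrow> expectation (Rn p X n) \<le> C * (E n / n + 1 / sqrt n ^ 2 + 1 / n)"
      unfolding E_def by (metis one_le_numeral)
    define m where "m = expectation (\<lambda>\<omega>. X 0 \<omega> ^ (p + 4))"
    have "m \<ge> 0"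
      unfolding m_def using pos[of 0] by (intro integral_nonneg_AE) (auto elim!: eventually_mono)
    define e where "e = - (real p - 2) / (real p + 4)"
    have "\<forall>\<^sub>F n in at_top. expectation (Rn p X n) \<le> (C * (m + 3)) * real n powr e"
      using eventually_ge_at_top[of 1]
    proof eventually_elim
      case (elim n)
      have "E n / n \<le> (1 + m) * n powr (2 / (p + 4) - 1)"
        unfolding E_def m_def using expectation_Mn_square_le_powr[OF _ int elim] by simp
      \<comment> \<open>The exponent on the left equals \<open>- (p + 2) / (p + 4)\<close>, which is
        at most \<open>e\<close>. The two remaining terms are both \<open>1 / n\<close>, and
        \<open>-1 \<le> e\<close>.\<close>
      also have "\<dots> \<le> (1 + m) * n powr e"
        using \<open>m \<ge> 0\<close> elim p2 unfolding e_def
        by (intro mult_left_mono powr_mono) (auto simp: field_simps)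
      finally have "E n / n \<le> (1 + m) * n powr e" .
      moreover have "n powr (-1) \<le> n powr e"
        using elim unfolding e_def by (intro powr_mono) (auto simp: field_simps)
      then have "1 / n \<le> n powr e" using elim by (simp add: powr_minus_divide)
      ultimately have "E n / n + 1 / sqrt n ^ 2 + 1 / n \<le> (m + 3) * n powr e"
        by (simp add: algebra_simps)
      then show ?case
        using C(3)[OF elim] mult_left_mono[OF _ C(1)] by (fastforce simp: mult.assoc)
    qed
    then show "(\<forall>\<^sub>F n in at_top. integrable M (Rn p X n))
        \<and> (\<lambda>n. integral\<^sup>L M (Rn p X n)) \<in> O(\<lambda>n. real n powr (- (real p - 2) / (real p + 4)))"
      unfolding e_def using C(2)
      by (intro conjI expectation_Rn_bigo) (auto intro: eventually_at_top_linorderI[of 1])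
  next
    assume "\<exists>\<epsilon>>0. integrable M (\<lambda>\<omega>. exp (\<epsilon> * X 0 \<omega>))"
    then obtain \<epsilon> where \<epsilon>: "\<epsilon> > 0" and int: "integrable M (\<lambda>\<omega>. exp (\<epsilon> * X 0 \<omega>))" by blast
    \<comment> \<open>Exponential moments dominate every power of
      \<open>\<epsilon> * X 0 \<omega>\<close>; the positive scale \<open>\<epsilon>\<close> is
      divided out afterwards.\<close>
    have "integrable M (\<lambda>\<omega>. (\<epsilon> * X 0 \<omega>) ^ (p + 2 + 2))"
    proof (rule Bochner_Integration.integrable_bound)
      show "integrable M (\<lambda>\<omega>. fact (p + 2 + 2) * exp (\<epsilon> * X 0 \<omega>))" using int by simp
      show "AE \<omega> in M. norm ((\<epsilon> * X 0 \<omega>) ^ (p + 2 + 2)) \<le> norm (fact (p + 2 + 2) * exp (\<epsilon> * X 0 \<omega>))"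
        using pos[of 0]
      proof eventually_elim
        case (elim \<omega>)
        then show ?case using \<epsilon> power_le_fact_exp[of "\<epsilon> * X 0 \<omega>" "p + 2 + 2"]
          by (simp add: abs_mult power_abs del: fact_Suc)
      qed
    qed (use rv in measurable)
    then have "integrable M (\<lambda>\<omega>. X 0 \<omega> ^ (p + 2 + 2))"
      using \<epsilon> by (simp only: power_mult_distrib integrable_mult_right_iff) simp
    from expectation_Rn_le[OF p2 _ this] obtain C where C: "C \<ge> 0"
      "\<And>n. n \<ge> 1 \<Longrightarrow> integrable M (Rn p X n)"
      "\<And>n. n \<ge> 1 \<Longrightarrow> expectation (Rn p X n) \<le> C * (E n / n + 1 / sqrt n ^ 2 + 1 / n)"
      unfolding E_def by (metis one_le_numeral)
    define m where "m = expectation (\<lambda>\<omega>. exp (\<epsilon> * X 0 \<omega>))"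
    have "m \<ge> 0" by (simp add: m_def)
    have "\<forall>\<^sub>F n in at_top. expectation (Rn p X n)
        \<le> (C * ((4 + 8 * m) / \<epsilon>\<^sup>2 + 2)) * ((ln (real n))\<^sup>2 / real n)"
      \<comment> \<open>From 3 on, \<open>ln n \<ge> 1\<close> because e <= 3, so constants can be
        absorbed into the squared logarithm.\<close>
      using eventually_ge_at_top[of 3]
    proof eventually_elim
      case (elim n)
      have "1 \<le> ln (real n)"
        using elim exp_le by (simp add: ln_ge_iff)
      then have L: "1 \<le> (ln (real n))\<^sup>2" by simp
      have "E n \<le> (4 * (ln n)\<^sup>2 + 8 * m) / \<epsilon>\<^sup>2"
        unfolding E_def m_def using elim by (intro expectation_Mn_square_le_ln \<epsilon> int) simp
      also have "\<dots> \<le> (4 * (ln n)\<^sup>2 + 8 * m * (ln n)\<^sup>2) / \<epsilon>\<^sup>2"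
        using mult_left_mono[OF L \<open>m \<ge> 0\<close>] by (intro divide_right_mono) auto
      also have "\<dots> = (4 + 8 * m) / \<epsilon>\<^sup>2 * (ln n)\<^sup>2"
        by (simp add: algebra_simps)
      finally have "E n + 2 \<le> ((4 + 8 * m) / \<epsilon>\<^sup>2 + 2) * (ln n)\<^sup>2"
        using L by (simp add: distrib_right)
      then have "(E n + 2) / n \<le> ((4 + 8 * m) / \<epsilon>\<^sup>2 + 2) * (ln n)\<^sup>2 / n"
        by (intro divide_right_mono) auto
      \<comment> \<open>For \<open>k = 2\<close> the term \<open>1 / sqrt n ^ 2\<close> is another
        \<open>1 / n\<close>, hence the 2 added to \<open>E n\<close>.\<close>
      moreover have "E n / n + 1 / sqrt n ^ 2 + 1 / n = (E n + 2) / n"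
        by (simp add: add_divide_distrib)
      ultimately have "C * (E n / n + 1 / sqrt n ^ 2 + 1 / n)
          \<le> C * (((4 + 8 * m) / \<epsilon>\<^sup>2 + 2) * (ln n)\<^sup>2 / n)"
        using C(1) by (intro mult_left_mono) auto
      then show ?case
        using C(3)[of n] elim by (simp add: mult.assoc)
    qed
    then show "(\<forall>\<^sub>F n in at_top. integrable M (Rn p X n))
        \<and> (\<lambda>n. integral\<^sup>L M (Rn p X n)) \<in> O(\<lambda>n. (ln (real n))^2 / real n)"
      using C(2) by (intro conjI expectation_Rn_bigo) (auto intro: eventually_at_top_linorderI[of 1])
  }
qed

end
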